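(* Let $(X,d,\succcurlyeq)$ be a radial partially ordered metric space and let $T$ be a nonempty set. For any $K\ge 0$, let $S$ be a nonempty subset of $X$ and let $f:S\to\ell_\infty(T)$ be an order-preserving $K$-Lipschitz map. Then there exists an order-preserving $K$-Lipschitz map $F:X\to\ell_\infty(T)$ with $F|_S=f$.
   Context: A partially ordered metric space is a triple $(X,d,\succcurlyeq)$ where $X$ is a nonempty set, $(X,d)$ is a metric space and $\succcurlyeq$ is a partial order on $X$; no compatibility between $d$ and $\succcurlyeq$ is assumed. Write $x\succ y$ if $x\succcurlyeq y$ and $x\neq y$, and write $x\succcurlyeq^{\bullet}y$ if it is not the case that $y\succcurlyeq x$. $(X,d,\succcurlyeq)$ is radial if for all $x,y,z\in X$: (i) $x\succcurlyeq^{\bullet}y\succ z$ implies $d(x,z)\ge d(x,y)$; and (ii) $x\succ y\succcurlyeq^{\bullet}z$ implies $d(x,z)\ge d(y,z)$. $\ell_\infty(T)$ is the Banach space of all bounded real functions on $T$ with the sup norm $\|\cdot\|_\infty$, partially ordered coordinatewise: $u\ge v$ iff $u(t)\ge v(t)$ for every $t\in T$. For $A\subseteq X$, a map $g:A\to\ell_\infty(T)$ is $K$-Lipschitz if $\|g(x)-g(y)\|_\infty\le K d(x,y)$ for all $x,y\in A$, and order-preserving if $g(x)\ge g(y)$ for all $x,y\in A$ with $x\succcurlyeq y$. *)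

theory Defs
  imports "HOL-Analysis.Analysis" "HOL-Probability.Discrete_Topology"
begin

text \<open>
  A partially ordered metric space is a type of sort \<open>{metric_space, order}\<close>: neither class
  constrains the other, so the distance and the order are unrelated.  Radiality is a property
  of the whole space and is therefore a predicate on the type.  The formulas \<open>\<not> x \<le> y\<close> and
  \<open>\<not> y \<le> z\<close> are the relations \<open>x \<succcurlyeq>\<^sup>\<bullet> y\<close> and \<open>y \<succcurlyeq>\<^sup>\<bullet> z\<close>, where \<open>a \<succcurlyeq>\<^sup>\<bullet> b\<close> is the
  negation of \<open>b \<succcurlyeq> a\<close>.
\<close>

definition radial :: "'a::{metric_space, order} itself \<Rightarrow> bool" where
  "radial _ \<longleftrightarrow>
    (\<forall>x y z :: 'a. \<not> x \<le> y \<and> y > z \<longrightarrow> dist x z \<ge> dist x y) \<and>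
    (\<forall>x y z :: 'a. x > y \<and> \<not> y \<le> z \<longrightarrow> dist x z \<ge> dist y z)"

text \<open>
  Every function on a discrete space is continuous, so the bounded continuous real functions on
  \<open>'t discrete\<close> are all the bounded real functions on \<open>'t\<close>; their norm is the sup norm.
\<close>

type_synonym 't linfty = "'t discrete \<Rightarrow>\<^sub>C real"

definition linfty_le :: "'t linfty \<Rightarrow> 't linfty \<Rightarrow> bool" where
  "linfty_le u v \<longleftrightarrow> (\<forall>t. apply_bcontfun u t \<le> apply_bcontfun v t)"

end

theory Submission
  imports Defs
begin

text \<open>
  Order preservation and the Lipschitz condition merge into a single one-sided estimate.  Put
  \<open>c x y = 0\<close> if \<open>x \<le> y\<close> and \<open>c x y = K \<cdot> dist x y\<close> otherwise.  A real function \<open>g\<close> is monotone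
  and \<open>K\<close>-Lipschitz if and only if \<open>g x - g y \<le> c x y\<close> for all \<open>x\<close>, \<open>y\<close>.  Radiality is what makes
  \<open>c\<close> satisfy the triangle inequality: the two clauses of its definition handle the two cases in
  which exactly one of \<open>x \<le> y\<close> and \<open>y \<le> z\<close> holds.  Hence \<open>c\<close> is an asymmetric
  pseudometric, and McShane's formula \<open>G x = (INF s\<in>S. g s + c x s)\<close>, whose
  justification never uses symmetry, extends every \<open>g\<close> on \<open>S\<close> with this estimate to the whole space.

  For a map into the bounded functions the formula is applied in every coordinate.  Since
  all coordinates share the constant \<open>K\<close>, the extended coordinates at \<open>x\<close> stay within
  \<open>K \<cdot> dist x s\<close> of those of \<open>f s\<close> for any fixed \<open>s \<in> S\<close>, so they again form a bounded function.
\<close>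

definition order_cost :: "real \<Rightarrow> 'a::{metric_space, order} \<Rightarrow> 'a \<Rightarrow> real" where
  "order_cost K x y = (if x \<le> y then 0 else K * dist x y)"

lemma order_cost_le:
  assumes "K \<ge> 0"
  shows "order_cost K x y \<le> K * dist x y"
  using assms by (simp add: order_cost_def)

text \<open>
  Only \<open>\<not> x \<le> z\<close> needs an argument, and then \<open>x \<le> y\<close> and \<open>y \<le> z\<close> cannot both hold.  If neither
  holds, this is the metric triangle inequality; if one holds, radiality bounds \<open>dist x z\<close> by the
  remaining distance alone.
\<close>

lemma order_cost_triangle:
  fixes x y z :: "'a::{metric_space, order}"
  assumes radial: "radial TYPE('a)" and K: "K \<ge> 0"
  shows "order_cost K x z \<le> order_cost K x y + order_cost K y z"
proof (cases "x \<le> z")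
  case True
  then show ?thesis
    using K by (simp add: order_cost_def)
next
  case False
  consider "x \<le> y" "\<not> y \<le> z" | "\<not> x \<le> y" "y \<le> z" | "\<not> x \<le> y" "\<not> y \<le> z"
    using False order_trans by blast
  then show ?thesis
  proof cases
    case 1
    have "dist x z \<le> dist y z"
      using radial 1 False unfolding radial_def by (cases "x = y") auto
    then show ?thesis
      using 1 False K by (simp add: order_cost_def mult_left_mono)
  next
    case 2
    have "dist x z \<le> dist x y"
      using radial 2 False unfolding radial_def by (cases "y = z") auto
    then show ?thesis
      using 2 False K by (simp add: order_cost_def mult_left_mono)
  next
    case 3
    have "K * dist x z \<le> K * (dist x y + dist y z)"
      using K by (intro mult_left_mono dist_triangle)
    then show ?thesis
      using 3 False by (simp add: order_cost_def distrib_left)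
  qed
qed

text \<open>
  McShane's extension for asymmetric costs.  Applying the hypothesis to a base point of \<open>S\<close>
  and the triangle inequality bounds the set of candidate values from below, so that the infimum
  is meaningful.
\<close>

lemma mcshane_extension:
  fixes c :: "'a \<Rightarrow> 'a \<Rightarrow> real" and g :: "'a \<Rightarrow> real"
  assumes refl: "\<And>x. c x x = 0"
    and triangle: "\<And>x y z. c x z \<le> c x y + c y z"
    and S: "S \<noteq> {}"
    and g: "\<And>x y. x \<in> S \<Longrightarrow> y \<in> S \<Longrightarrow> g x - g y \<le> c x y"
  shows "\<exists>G. (\<forall>x y. G x - G y \<le> c x y) \<and> (\<forall>x\<in>S. G x = g x)"
proof -
  define G where "G x = (INF s\<in>S. g s + c x s)" for x
  obtain s0 where s0: "s0 \<in> S"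
    using S by blast
  have bdd: "bdd_below ((\<lambda>s. g s + c x s) ` S)" for x
  proof (rule bdd_belowI2)
    fix s assume "s \<in> S"
    then show "g s0 - c s0 x \<le> g s + c x s"
      using g[OF s0, of s] triangle[of s0 s x] by linarith
  qed
  have "G x - c x y \<le> G y" for x y
    unfolding G_def[of y]
  proof (rule cINF_greatest[OF S])
    fix s assume "s \<in> S"
    then have "G x \<le> g s + c x s"
      unfolding G_def by (rule cINF_lower[OF bdd])
    then show "G x - c x y \<le> g s + c y s"
      using triangle[of x s y] by linarith
  qed
  then have "G x - G y \<le> c x y" for x y
    by (metis diff_le_eq add.commute)
  moreover have "G x = g x" if x: "x \<in> S" for x
  proof (rule antisym)
    show "G x \<le> g x"
      using cINF_lower[OF bdd x, of x] by (simp add: G_def refl)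
    show "g x \<le> G x"
      unfolding G_def
      using g[OF x] by (intro cINF_greatest[OF S]) (simp add: algebra_simps)
  qed
  ultimately show ?thesis
    by blast
qed

lemma dist_linfty_le_iff:
  fixes u v :: "'t linfty"
  shows "dist u v \<le> b \<longleftrightarrow> (\<forall>t. \<bar>apply_bcontfun u t - apply_bcontfun v t\<bar> \<le> b)"
  by (metis dist_bound dist_bounded dist_real_def order_trans)

text \<open>
  The cost packs both conditions into one estimate: a pair with \<open>x \<le> y\<close> gives monotonicity when
  read as \<open>(x, y)\<close>, and the estimates for \<open>(x, y)\<close> and \<open>(y, x)\<close> together give the Lipschitz
  bound.  Both directions of the equivalence matter: on \<open>S\<close> to feed McShane's formula, on the whole space to
  read off the result.
\<close>

lemma monotone_lipschitz_iff_order_cost: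
  fixes h :: "'a::{metric_space, order} \<Rightarrow> 't linfty"
  assumes K: "K \<ge> 0"
  shows "monotone_on A (\<le>) linfty_le h \<and> K-lipschitz_on A h \<longleftrightarrow>
    (\<forall>x\<in>A. \<forall>y\<in>A. \<forall>t. apply_bcontfun (h x) t - apply_bcontfun (h y) t \<le> order_cost K x y)"
    (is "?L \<longleftrightarrow> ?R")
proof
  assume ?L
  then have mono: "monotone_on A (\<le>) linfty_le h" and lip: "K-lipschitz_on A h"
    by auto
  show ?R
  proof (intro ballI allI)
    fix x y t assume A: "x \<in> A" "y \<in> A"
    have "apply_bcontfun (h x) t \<le> apply_bcontfun (h y) t" if "x \<le> y"
      using monotone_onD[OF mono A that] by (simp add: linfty_le_def)
    moreover have "\<bar>apply_bcontfun (h x) t - apply_bcontfun (h y) t\<bar> \<le> K * dist x y"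
      using lipschitz_onD[OF lip A] by (simp add: dist_linfty_le_iff)
    ultimately show "apply_bcontfun (h x) t - apply_bcontfun (h y) t \<le> order_cost K x y"
      by (auto simp: order_cost_def)
  qed
next
  assume R: ?R
  have "monotone_on A (\<le>) linfty_le h"
    using R by (force intro!: monotone_onI simp: linfty_le_def order_cost_def)
  moreover have "dist (h x) (h y) \<le> K * dist x y" if A: "x \<in> A" "y \<in> A" for x y
    unfolding dist_linfty_le_iff
  proof
    fix t
    have "apply_bcontfun (h x) t - apply_bcontfun (h y) t \<le> K * dist x y"
      using R A order_cost_le[OF K, of x y] by (meson order_trans)
    moreover have "apply_bcontfun (h y) t - apply_bcontfun (h x) t \<le> K * dist x y"
      using R A order_cost_le[OF K, of y x] by (metis dist_commute order_trans)
    ultimately show "\<bar>apply_bcontfun (h x) t - apply_bcontfun (h y) t\<bar> \<le> K * dist x y"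
      by linarith
  qed
  ultimately show ?L
    using K by (auto intro: lipschitz_onI)
qed

theorem theorem4:
  fixes S :: "'a::{metric_space, order} set"
    and f :: "'a \<Rightarrow> 't linfty"
    and K :: real
  assumes "radial TYPE('a)"
    and "K \<ge> 0"
    and "S \<noteq> {}"
    and "monotone_on S (\<le>) linfty_le f"
    and "K-lipschitz_on S f"
  shows "\<exists>F :: 'a \<Rightarrow> 't linfty.
    monotone_on UNIV (\<le>) linfty_le F \<and> K-lipschitz_on UNIV F \<and> (\<forall>x\<in>S. F x = f x)"
proof -
  have f: "apply_bcontfun (f x) t - apply_bcontfun (f y) t \<le> order_cost K x y"
    if "x \<in> S" "y \<in> S" for x y t
    using monotone_lipschitz_iff_order_cost[OF \<open>K \<ge> 0\<close>, of S f] assms(4,5) that by blast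
  have "\<exists>G. (\<forall>x y. G x - G y \<le> order_cost K x y) \<and> (\<forall>x\<in>S. G x = apply_bcontfun (f x) t)" for t
    using order_cost_triangle[OF assms(1,2)] \<open>S \<noteq> {}\<close> f
    by (intro mcshane_extension) (auto simp: order_cost_def[of K x x for x])
  then obtain G where
    G: "\<And>t x y. G t x - G t y \<le> order_cost K x y" and
    G_eq: "\<And>t x. x \<in> S \<Longrightarrow> G t x = apply_bcontfun (f x) t"
    by metis
  obtain s where s: "s \<in> S"
    using \<open>S \<noteq> {}\<close> by blast
  have bounded: "(\<lambda>t. G t x) \<in> bcontfun" for x
  proof (rule bcontfun_normI)
    show "continuous_on UNIV (\<lambda>t. G t x)"
      by (simp add: continuous_on_open_vimage open_discrete)
    fix t
    have "G t x - G t s \<le> K * dist x s"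
      using G[of t x s] order_cost_le[OF \<open>K \<ge> 0\<close>, of x s] by linarith
    moreover have "G t s - G t x \<le> K * dist x s"
      using G[of t s x] order_cost_le[OF \<open>K \<ge> 0\<close>, of s x] by (simp add: dist_commute)
    moreover have "\<bar>G t s\<bar> \<le> norm (f s)"
      using norm_bounded[of "f s" t] by (simp add: G_eq[OF s])
    ultimately show "norm (G t x) \<le> norm (f s) + K * dist x s"
      by simp
  qed
  define F where "F x = Bcontfun (\<lambda>t. G t x)" for x
  have apply_F: "apply_bcontfun (F x) t = G t x" for x t
    by (simp add: F_def Bcontfun_inverse[OF bounded])
  have "monotone_on UNIV (\<le>) linfty_le F \<and> K-lipschitz_on UNIV F"
    by (simp add: monotone_lipschitz_iff_order_cost[OF \<open>K \<ge> 0\<close>] apply_F G)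
  moreover have "F x = f x" if "x \<in> S" for x
    by (rule bcontfun_eqI) (simp add: apply_F G_eq[OF that])
  ultimately show ?thesis
    by blast
qed

end
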